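(* There is an infinite family of (pairwise non-isomorphic) finite strongly connected digraphs $G_n$, none of which is Eulerian, such that for each $n$ (and for any choice of cyclic orderings of the edges emanating from each vertex of $G_n$) all recurrent states of $G_n$ are in a single orbit of the rotor-router operation.
   Context: Digraphs may have loops and multi-edges. A strongly connected digraph is Eulerian if every vertex has indegree equal to its outdegree. Rotor-router operation on a finite digraph $G=(V,E)$ without sink (a sink is a vertex of outdegree $0$): for each vertex $v$ the set of edges emanating from $v$ is equipped with a cyclic ordering, and $e^{+}$ denotes the edge following $e$ in the cyclic ordering at the tail of $e$. A rotor configuration is a map $\rho:V\to E$ such that $\rho(v)$ is an edge emanating from $v$ for each $v$. A (single-chip-and-rotor) state is a pair $(v,\rho)$ with $v\in V$ (the location of the chip) and $\rho$ a rotor configuration. The rotor-router operation sends $(v,\rho)$ to $(v',\rho')$, where $\rho'(v)=\rho(v)^{+}$, $\rho'(u)=\rho(u)$ for $u\ne v$, and $v'$ is the head of $\rho'(v)$. A state is recurrent if iterating the rotor-router operation a positive number of times starting from it gives the same state again. The orbit of a recurrent state is the set of all states reachable from it by iterating the rotor-router operation. *)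

theory Defs
  imports "Graph_Theory.Digraph_Isomorphism" "HOL-Combinatorics.Orbits" "HOL-Library.FuncSet"
begin

definition eulerian_digraph :: "('a, 'b) pre_digraph \<Rightarrow> bool" where
  "eulerian_digraph G \<longleftrightarrow>
     strongly_connected G \<and> (\<forall>v \<in> verts G. in_degree G v = out_degree G v)"

text \<open>
  Cyclic orderings of the arcs emanating from the vertices are given by a single successor
  function on arcs, which permutes the arcs emanating from each vertex in one cycle.
  As \<^const>\<open>cyclic_on\<close> only holds for nonempty sets, such a function exists only if the
  digraph has no sink; a strongly connected digraph that is not Eulerian never has one.
\<close>
definition rotor_ordering :: "('a, 'b) pre_digraph \<Rightarrow> ('b \<Rightarrow> 'b) \<Rightarrow> bool" where
  "rotor_ordering G nxt \<longleftrightarrow> (\<forall>v \<in> verts G. cyclic_on nxt (out_arcs G v))"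

text \<open>
  Rotor configurations are extensional functions, so that equality of states only depends
  on the rotors at the vertices of the digraph.
\<close>
definition rotor_states :: "('a, 'b) pre_digraph \<Rightarrow> ('a \<times> ('a \<Rightarrow> 'b)) set" where
  "rotor_states G = verts G \<times> (\<Pi>\<^sub>E v \<in> verts G. out_arcs G v)"

definition rotor_step ::
  "('a, 'b) pre_digraph \<Rightarrow> ('b \<Rightarrow> 'b) \<Rightarrow> 'a \<times> ('a \<Rightarrow> 'b) \<Rightarrow> 'a \<times> ('a \<Rightarrow> 'b)" where
  "rotor_step G nxt = (\<lambda>(v, \<rho>). (head G (nxt (\<rho> v)), \<rho>(v := nxt (\<rho> v))))"

definition recurrent_states ::
  "('a, 'b) pre_digraph \<Rightarrow> ('b \<Rightarrow> 'b) \<Rightarrow> ('a \<times> ('a \<Rightarrow> 'b)) set" where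
  "recurrent_states G nxt =
     {s \<in> rotor_states G. \<exists>k>0. (rotor_step G nxt ^^ k) s = s}"

definition rotor_orbit ::
  "('a, 'b) pre_digraph \<Rightarrow> ('b \<Rightarrow> 'b) \<Rightarrow> 'a \<times> ('a \<Rightarrow> 'b) \<Rightarrow> ('a \<times> ('a \<Rightarrow> 'b)) set" where
  "rotor_orbit G nxt s = {(rotor_step G nxt ^^ k) s | k. True}"

end

theory Submission
  imports Defs
begin

text \<open>
  In a strongly connected digraph where all vertices but one have a single outgoing arc, the
  rotor-router operation has only one cycle of states: the rotors at those vertices never change, the chip returns
  to the exceptional vertex along a forced path, and each visit there advances its rotor by one
  place. As the cyclic ordering is one cycle, every position of that rotor comes up, whatever the
  ordering is. Two vertices suffice for such a digraph that is not Eulerian, with several parallel arcs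
  one way and a single arc back; the number of parallel arcs separates the members of
  the family up to isomorphism. Here every state is recurrent, because on the states with the chip at the
  exceptional vertex, two steps of the operation act as the successor function on the parallel arcs
  (\<open>rotor_step_twice_funpow\<close>).
\<close>

definition parallel_arcs_digraph :: "nat \<Rightarrow> (nat, nat) pre_digraph" where
  "parallel_arcs_digraph n =
     \<lparr>verts = {0, 1}, arcs = {..n},
      tail = (\<lambda>a. if a = 0 then 1 else 0), head = (\<lambda>a. if a = 0 then 0 else 1)\<rparr>"

text \<open>
  Arc \<open>0\<close> is the return arc, so the rotor at vertex \<open>1\<close> always points to it and \<open>a\<close>, the rotor at
  vertex \<open>0\<close>, is all that can vary. Outside the two vertices the value has to be \<open>undefined\<close>
  for the configuration to be extensional.
\<close>
definition rotors :: "nat \<Rightarrow> nat \<Rightarrow> nat" where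
  "rotors a = (\<lambda>_. undefined)(0 := a, 1 := 0)"

lemma verts_parallel: "verts (parallel_arcs_digraph n) = {0, 1}"
  by (simp add: parallel_arcs_digraph_def)

lemma out_arcs_parallel:
  "out_arcs (parallel_arcs_digraph n) 0 = {1..n}"
  "out_arcs (parallel_arcs_digraph n) (Suc 0) = {0}"
  by (auto simp: out_arcs_def parallel_arcs_digraph_def split: if_splits)

lemma in_arcs_parallel: "in_arcs (parallel_arcs_digraph n) 0 = {0}"
  by (auto simp: in_arcs_def parallel_arcs_digraph_def split: if_splits)

lemma fin_digraph_parallel: "fin_digraph (parallel_arcs_digraph n)"
  by unfold_locales (auto simp: parallel_arcs_digraph_def)

lemma strongly_connected_parallel:
  assumes "n > 0"
  shows "strongly_connected (parallel_arcs_digraph n)"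
proof -
  let ?G = "parallel_arcs_digraph n"
  interpret fin_digraph ?G by (rule fin_digraph_parallel)
  have arc: "tail ?G a \<rightarrow>\<^bsub>?G\<^esub> head ?G a" if "a \<le> n" for a
    using that by (auto simp: parallel_arcs_digraph_def arcs_ends_def arc_to_ends_def)
  have "0 \<rightarrow>\<^bsub>?G\<^esub> 1" "1 \<rightarrow>\<^bsub>?G\<^esub> 0"
    using arc[of 1] arc[of 0] assms by (simp_all add: parallel_arcs_digraph_def)
  then have "u \<rightarrow>\<^sup>*\<^bsub>?G\<^esub> v" if "u \<in> {0, 1}" "v \<in> {0, 1}" for u v
    using that by (auto simp: verts_parallel)
  then show ?thesis
    by (simp add: strongly_connected_def verts_parallel)
qed

lemma not_eulerian_parallel:
  assumes "n > 1"
  shows "\<not> eulerian_digraph (parallel_arcs_digraph n)"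
proof
  assume "eulerian_digraph (parallel_arcs_digraph n)"
  then have "in_degree (parallel_arcs_digraph n) 0 = out_degree (parallel_arcs_digraph n) 0"
    by (simp add: eulerian_digraph_def verts_parallel)
  with assms show False
    by (simp add: in_degree_def out_degree_def in_arcs_parallel out_arcs_parallel)
qed

lemma digraph_iso_parallel:
  assumes "digraph_iso (parallel_arcs_digraph m) (parallel_arcs_digraph n)"
  shows "m = n"
proof -
  interpret fin_digraph "parallel_arcs_digraph m" by (rule fin_digraph_parallel)
  from assms obtain hom where "digraph_isomorphism hom"
    and hom: "parallel_arcs_digraph n = app_iso hom (parallel_arcs_digraph m)"
    by (auto simp: digraph_iso_def)
  then have "inj_on (iso_arcs hom) (arcs (parallel_arcs_digraph m))"
    by (simp add: digraph_isomorphism_def)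
  moreover have "arcs (parallel_arcs_digraph n) = iso_arcs hom ` arcs (parallel_arcs_digraph m)"
    unfolding hom by simp
  ultimately have "card (arcs (parallel_arcs_digraph n)) = card (arcs (parallel_arcs_digraph m))"
    by (simp add: card_image)
  then show ?thesis
    by (simp add: parallel_arcs_digraph_def)
qed

lemma rotor_states_parallel:
  "rotor_states (parallel_arcs_digraph n) = {0, 1} \<times> rotors ` {1..n}"
proof -
  have "(\<Pi>\<^sub>E v \<in> {0, 1}. out_arcs (parallel_arcs_digraph n) v) = rotors ` {1..n}" (is "?C = _")
  proof
    show "?C \<subseteq> rotors ` {1..n}"
    proof
      fix \<rho> assume \<rho>: "\<rho> \<in> ?C"
      have arcs: "\<rho> 0 \<in> {1..n}" "\<rho> 1 = 0"
        using PiE_mem[OF \<rho>, of 0] PiE_mem[OF \<rho>, of 1] by (simp_all add: out_arcs_parallel)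
      have "\<rho> v = rotors (\<rho> 0) v" for v
        using arcs(2) PiE_arb[OF \<rho>, of v] by (simp add: rotors_def)
      then have "\<rho> = rotors (\<rho> 0)" ..
      with arcs(1) show "\<rho> \<in> rotors ` {1..n}" by blast
    qed
    show "rotors ` {1..n} \<subseteq> ?C"
      by (auto simp: rotors_def out_arcs_parallel PiE_iff extensional_def split: if_splits)
  qed
  then show ?thesis
    by (simp add: rotor_states_def verts_parallel)
qed

context
  fixes n :: nat and nxt :: "nat \<Rightarrow> nat"
  assumes ordering: "rotor_ordering (parallel_arcs_digraph n) nxt"
begin

lemma cyclic_parallel: "cyclic_on nxt {1..n}"
  using ordering by (simp add: rotor_ordering_def verts_parallel out_arcs_parallel)

lemma nxt_return_arc: "nxt 0 = 0"
proof -
  have "cyclic_on nxt {0}"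
    using ordering by (simp add: rotor_ordering_def verts_parallel out_arcs_parallel)
  then show ?thesis
    using cyclic_on_funpow_in[of nxt "{0}" 0 1] by simp
qed

lemma funpow_nxt_in: "a \<in> {1..n} \<Longrightarrow> (nxt ^^ k) a \<in> {1..n}"
  using cyclic_on_funpow_in[OF cyclic_parallel] by simp

lemma rotor_step_outward:
  assumes "a \<in> {1..n}"
  shows "rotor_step (parallel_arcs_digraph n) nxt (0, rotors a) = (1, rotors (nxt a))"
  using funpow_nxt_in[OF assms, of 1]
  by (auto simp: rotor_step_def parallel_arcs_digraph_def rotors_def fun_upd_twist)

lemma rotor_step_return:
  "rotor_step (parallel_arcs_digraph n) nxt (1, rotors a) = (0, rotors a)"
  by (simp add: rotor_step_def parallel_arcs_digraph_def rotors_def nxt_return_arc)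

lemma rotor_step_twice_funpow:
  assumes "a \<in> {1..n}"
  shows "(rotor_step (parallel_arcs_digraph n) nxt ^^ (2 * k)) (0, rotors a)
    = (0, rotors ((nxt ^^ k) a))"
  by (induction k)
     (use funpow_nxt_in[OF assms] in \<open>simp_all add: rotor_step_outward rotor_step_return[simplified]\<close>)

text \<open>
  Every arc \<open>b\<close> out of vertex \<open>0\<close> is \<open>nxt\<^sup>k a\<close> for a positive \<open>k\<close>, even if \<open>b = a\<close>. This gives the
  states with the chip at \<open>0\<close> after \<open>2 * k\<close> steps; since the chip moves out only after the rotor has
  advanced, the states with the chip at \<open>1\<close> come one step earlier, after \<open>2 * k - 1\<close> steps.
\<close>
lemma reach_all_states:
  assumes a: "a \<in> {1..n}" and s: "s \<in> rotor_states (parallel_arcs_digraph n)"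
  shows "\<exists>k>0. (rotor_step (parallel_arcs_digraph n) nxt ^^ k) (0, rotors a) = s"
proof -
  let ?step = "rotor_step (parallel_arcs_digraph n) nxt"
  from s obtain v b where s_eq: "s = (v, rotors b)" and v: "v \<in> {0, 1}" and b: "b \<in> {1..n}"
    by (auto simp: rotor_states_parallel)
  have "b \<in> orbit nxt a"
    using orbit_cyclic_eq3[OF cyclic_parallel a] b by simp
  then obtain k where "k > 0" and k: "b = (nxt ^^ k) a"
    by (auto simp: orbit_altdef)
  then obtain j where j: "k = Suc j"
    by (cases k) auto
  from v consider "v = 0" | "v = 1" by auto
  then show ?thesis
  proof cases
    case 1
    then have "(?step ^^ (2 * k)) (0, rotors a) = s"
      using rotor_step_twice_funpow[OF a, of k] by (simp add: s_eq k)
    with \<open>k > 0\<close> show ?thesis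
      by (intro exI[of _ "2 * k"]) simp
  next
    case 2
    have "(?step ^^ Suc (2 * j)) (0, rotors a) = s"
      using rotor_step_twice_funpow[OF a, of j] funpow_nxt_in[OF a, of j]
      by (simp add: s_eq k j 2 rotor_step_outward)
    then show ?thesis by blast
  qed
qed

lemma single_orbit_parallel:
  assumes "n > 0"
  shows "\<exists>s \<in> recurrent_states (parallel_arcs_digraph n) nxt.
    recurrent_states (parallel_arcs_digraph n) nxt \<subseteq> rotor_orbit (parallel_arcs_digraph n) nxt s"
proof
  have arc: "1 \<in> {1..n}"
    using assms by simp
  then have "(0, rotors 1) \<in> rotor_states (parallel_arcs_digraph n)"
    by (simp add: rotor_states_parallel)
  with reach_all_states[OF arc]
  show "(0, rotors 1) \<in> recurrent_states (parallel_arcs_digraph n) nxt"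
    by (simp add: recurrent_states_def)
  show "recurrent_states (parallel_arcs_digraph n) nxt
    \<subseteq> rotor_orbit (parallel_arcs_digraph n) nxt (0, rotors 1)"
    using reach_all_states[OF arc] unfolding recurrent_states_def rotor_orbit_def by blast
qed

end

theorem theorem2:
  shows "\<exists>G :: nat \<Rightarrow> (nat, nat) pre_digraph.
    (\<forall>m n. m \<noteq> n \<longrightarrow> \<not> digraph_iso (G m) (G n)) \<and>
    (\<forall>n. fin_digraph (G n) \<and> strongly_connected (G n) \<and> \<not> eulerian_digraph (G n) \<and>
      (\<forall>nxt. rotor_ordering (G n) nxt \<longrightarrow>
        (\<exists>s \<in> recurrent_states (G n) nxt.
          recurrent_states (G n) nxt \<subseteq> rotor_orbit (G n) nxt s)))"
proof -
  \<comment> \<open>With a single arc each way the digraph is Eulerian, so the family starts at two parallel arcs.\<close>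
  let ?G = "\<lambda>n. parallel_arcs_digraph (n + 2)"
  have "\<not> digraph_iso (?G m) (?G n)" if "m \<noteq> n" for m n
    using digraph_iso_parallel[of "m + 2" "n + 2"] that by auto
  then show ?thesis
    by (intro exI[of _ ?G])
       (simp add: fin_digraph_parallel strongly_connected_parallel not_eulerian_parallel
         single_orbit_parallel)
qed

end
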